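(* The lax orthogonal factorisation system $(\mathsf{L}_Q,\mathsf{R}_Q)$ on the $\mathbf{Ord}$-category $\mathbf{Met}_{\mathrm{sk}}$ of skeletal generalised metric spaces restricts to an orthogonal factorisation system on the category of metric spaces (and non-expansive maps). Its left maps are the dense isometries.
   Context: A generalised metric space is a set $A$ with a function $A(-,-)\colon A\times A\to[0,\infty]$ satisfying $A(a,a)=0$ and the triangle inequality $A(a,b)+A(b,c)\ge A(a,c)$ (distances may be infinite, non-symmetric, and zero between distinct points); it is skeletal if $A(a,b)=0=A(b,a)$ implies $a=b$. Metric spaces in the usual sense are skeletal generalised metric spaces with symmetric distance. $\mathbf{Met}_{\mathrm{sk}}$ has skeletal generalised metric spaces as objects, non-expansive maps ($A(a,b)\ge B(f(a),f(b))$) as morphisms, and $f\le g\colon A\to B$ iff $B(f(a),g(a))=0$ for all $a$. This is an $\mathbf{Ord}$-category (hom-sets are posets, composition monotone). The monad $\mathsf{Q}$ on $\mathbf{Met}_{\mathrm{sk}}$: a Cauchy sequence in $A$ is a sequence $(a_n)$ such that for every $\epsilon>0$ there is $n_0$ with $A(a_n,a_m)<\epsilon$ for all $n,m\ge n_0$; $(a_n)$ and $(b_n)$ are equivalent if $A(a_n,b_n)\to0$ and $A(b_n,a_n)\to0$. $QA$ is the set of equivalence classes of Cauchy sequences with $QA([a_n],[b_n])=\lim_nA(a_n,b_n)$; $Qf[a_n]=[f(a_n)]$; the unit $A\to QA$ sends $a$ to the class $c_a$ of the constant sequence; the multiplication sends a Cauchy sequence in $QA$ to its limit in $QA$. $\mathsf{Q}$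 is a simple lax idempotent $\mathbf{Ord}$-monad. $(\mathsf{L}_Q,\mathsf{R}_Q)$ is the factorisation system generated by $\mathsf{Q}$: it factors $f\colon A\to B$ as $A\xrightarrow{Lf}Kf\xrightarrow{Rf}B$, where $Kf=\{(\xi,b)\in QA\times B: Qf(\xi)\le c_b\}$ is the comma-object of $Qf$ and $B\to QB$ (with the maximum distance inherited from $QA\times B$; $\xi\le\xi'$ means distance from $\xi$ to $\xi'$ is $0$), $Lf(a)=(c_a,f(a))$, $Rf(\xi,b)=b$. Here $f\mapsto Lf$ underlies a lax idempotent comonad $\mathsf{L}_Q$ and $f\mapsto Rf$ a lax idempotent monad $\mathsf{R}_Q$ on the arrow category, forming an algebraic weak factorisation system; the $\mathsf{L}_Q$-coalgebras (the left maps) are the $\mathsf{Q}$-embeddings, i.e. those $f$ for which there is $r\colon QB\to QA$ with $r\cdot Qf=1$, $Qf\cdot r\le1$, and the right maps are the $\mathsf{R}_Q$-algebras. "Restricts" means that when $A,B$ are metric spaces so is $Kf$, and the induced factorisation system on metric spaces (left maps the $\mathsf{L}_Q$-coalgebras, right maps the $\mathsf{R}_Q$-algebras, between metric spaces) is an orthogonal factorisation system. An isometry is a distance-preserving map; $f\colon A\to B$ between metric spaces is dense if every $b\in B$ is a limit of a sequence $(f(x_n))$ with $x_n\in A$. *)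

theory Defs
  imports "HOL-Analysis.Analysis"
begin

section \<open>Generalised metric spaces\<close>

record 'a gms =
  pts :: "'a set"
  gd :: "'a \<Rightarrow> 'a \<Rightarrow> ennreal"

definition gen_metric :: "'a gms \<Rightarrow> bool" where
  "gen_metric A \<longleftrightarrow>
     (\<forall>a\<in>pts A. gd A a a = 0) \<and>
     (\<forall>a\<in>pts A. \<forall>b\<in>pts A. \<forall>c\<in>pts A. gd A a c \<le> gd A a b + gd A b c)"

text \<open>The order underlying the \<open>Ord\<close>-enrichment: hom-sets are ordered pointwise by it.\<close>

definition gms_le :: "'a gms \<Rightarrow> 'a \<Rightarrow> 'a \<Rightarrow> bool" where
  "gms_le A x y \<longleftrightarrow> gd A x y = 0"

definition skeletal :: "'a gms \<Rightarrow> bool" where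
  "skeletal A \<longleftrightarrow> gen_metric A \<and>
     (\<forall>a\<in>pts A. \<forall>b\<in>pts A. gms_le A a b \<and> gms_le A b a \<longrightarrow> a = b)"

text \<open>The value \<open>\<infinity>\<close> remains allowed as a distance in a metric space.\<close>

definition metric_sp :: "'a gms \<Rightarrow> bool" where
  "metric_sp A \<longleftrightarrow> skeletal A \<and> (\<forall>a\<in>pts A. \<forall>b\<in>pts A. gd A a b = gd A b a)"

text \<open>Values of a map outside the carrier of its domain are irrelevant; accordingly all
  equations between maps below are stated on carriers.\<close>

definition gms_hom :: "'a gms \<Rightarrow> 'b gms \<Rightarrow> ('a \<Rightarrow> 'b) \<Rightarrow> bool" where
  "gms_hom A B f \<longleftrightarrow> f \<in> pts A \<rightarrow> pts B \<and>
     (\<forall>a\<in>pts A. \<forall>a'\<in>pts A. gd B (f a) (f a') \<le> gd A a a')"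

definition gms_iso :: "'a gms \<Rightarrow> 'b gms \<Rightarrow> ('a \<Rightarrow> 'b) \<Rightarrow> bool" where
  "gms_iso A B f \<longleftrightarrow> gms_hom A B f \<and>
     (\<exists>g. gms_hom B A g \<and> (\<forall>a\<in>pts A. g (f a) = a) \<and> (\<forall>b\<in>pts B. f (g b) = b))"

text \<open>Since distances need not be symmetric, convergence is required in both directions.\<close>

definition gms_lim :: "'a gms \<Rightarrow> (nat \<Rightarrow> 'a) \<Rightarrow> 'a \<Rightarrow> bool" where
  "gms_lim A x a \<longleftrightarrow> a \<in> pts A \<and>
     (\<lambda>n. gd A (x n) a) \<longlonglongrightarrow> 0 \<and> (\<lambda>n. gd A a (x n)) \<longlonglongrightarrow> 0"

definition isometry :: "'a gms \<Rightarrow> 'b gms \<Rightarrow> ('a \<Rightarrow> 'b) \<Rightarrow> bool" where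
  "isometry A B f \<longleftrightarrow> f \<in> pts A \<rightarrow> pts B \<and>
     (\<forall>a\<in>pts A. \<forall>a'\<in>pts A. gd B (f a) (f a') = gd A a a')"

definition dense_map :: "'a gms \<Rightarrow> 'b gms \<Rightarrow> ('a \<Rightarrow> 'b) \<Rightarrow> bool" where
  "dense_map A B f \<longleftrightarrow>
     (\<forall>b\<in>pts B. \<exists>x. (\<forall>n. x n \<in> pts A) \<and> gms_lim B (\<lambda>n. f (x n)) b)"


section \<open>The monad \<open>Q\<close>\<close>

definition gms_Cauchy :: "'a gms \<Rightarrow> (nat \<Rightarrow> 'a) \<Rightarrow> bool" where
  "gms_Cauchy A x \<longleftrightarrow> (\<forall>n. x n \<in> pts A) \<and>
     (\<forall>\<epsilon>>0. \<exists>n\<^sub>0. \<forall>n\<ge>n\<^sub>0. \<forall>m\<ge>n\<^sub>0. gd A (x n) (x m) < \<epsilon>)"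

definition Cauchy_equiv :: "'a gms \<Rightarrow> (nat \<Rightarrow> 'a) \<Rightarrow> (nat \<Rightarrow> 'a) \<Rightarrow> bool" where
  "Cauchy_equiv A x y \<longleftrightarrow>
     (\<lambda>n. gd A (x n) (y n)) \<longlonglongrightarrow> 0 \<and> (\<lambda>n. gd A (y n) (x n)) \<longlonglongrightarrow> 0"

definition Q_class :: "'a gms \<Rightarrow> (nat \<Rightarrow> 'a) \<Rightarrow> (nat \<Rightarrow> 'a) set" where
  "Q_class A x = {y. gms_Cauchy A y \<and> Cauchy_equiv A x y}"

definition Q_obj :: "'a gms \<Rightarrow> (nat \<Rightarrow> 'a) set gms" where
  "Q_obj A = \<lparr>pts = {Q_class A x | x. gms_Cauchy A x},
     gd = (\<lambda>\<xi> \<zeta>. THE r. \<exists>x\<in>\<xi>. \<exists>y\<in>\<zeta>. (\<lambda>n. gd A (x n) (y n)) \<longlonglongrightarrow> r)\<rparr>"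

text \<open>The argument \<open>B\<close> is the codomain of \<open>f\<close>. All sets in the union coincide
  when \<open>\<xi>\<close> is a class of Cauchy sequences and \<open>f\<close> is non-expansive.\<close>

definition Q_map :: "'b gms \<Rightarrow> ('a \<Rightarrow> 'b) \<Rightarrow> (nat \<Rightarrow> 'a) set \<Rightarrow> (nat \<Rightarrow> 'b) set" where
  "Q_map B f \<xi> = (\<Union>x\<in>\<xi>. Q_class B (\<lambda>n. f (x n)))"

definition Q_unit :: "'a gms \<Rightarrow> 'a \<Rightarrow> (nat \<Rightarrow> 'a) set" where
  "Q_unit A a = Q_class A (\<lambda>_. a)"

definition Q_mult :: "'a gms \<Rightarrow> (nat \<Rightarrow> (nat \<Rightarrow> 'a) set) set \<Rightarrow> (nat \<Rightarrow> 'a) set" where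
  "Q_mult A \<Xi> = (THE \<xi>. \<exists>X\<in>\<Xi>. gms_lim (Q_obj A) X \<xi>)"


section \<open>The factorisation system generated by \<open>Q\<close>\<close>

type_synonym ('a, 'b) K = "(nat \<Rightarrow> 'a) set \<times> 'b"

definition K_obj :: "'a gms \<Rightarrow> 'b gms \<Rightarrow> ('a \<Rightarrow> 'b) \<Rightarrow> ('a, 'b) K gms" where
  "K_obj A B f =
     \<lparr>pts = {(\<xi>, b). \<xi> \<in> pts (Q_obj A) \<and> b \<in> pts B \<and>
                      gms_le (Q_obj B) (Q_map B f \<xi>) (Q_unit B b)},
      gd = (\<lambda>(\<xi>, b) (\<xi>', b'). max (gd (Q_obj A) \<xi> \<xi>') (gd B b b'))\<rparr>"

definition L_map :: "'a gms \<Rightarrow> ('a \<Rightarrow> 'b) \<Rightarrow> 'a \<Rightarrow> ('a, 'b) K" where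
  "L_map A f a = (Q_unit A a, f a)"

definition R_map :: "('a, 'b) K \<Rightarrow> 'b" where
  "R_map = snd"

text \<open>The map \<open>K(h,k) : Kf \<rightarrow> Kg\<close> induced by a commutative square \<open>k \<cdot> f = g \<cdot> h\<close>;
  \<open>A'\<close> is the domain of \<open>g\<close>, that is, the codomain of \<open>h\<close>.\<close>

definition K_map :: "'c gms \<Rightarrow> ('a \<Rightarrow> 'c) \<Rightarrow> ('b \<Rightarrow> 'd) \<Rightarrow> ('a, 'b) K \<Rightarrow> ('c, 'd) K" where
  "K_map A' h k = (\<lambda>(\<xi>, b). (Q_map A' h \<xi>, k b))"

text \<open>The comultiplication \<open>Kf \<rightarrow> K(Lf)\<close> of the comonad; as a map it is the only one satisfying
  the two counit laws.\<close>

definition L_comult :: "('a, 'b) K \<Rightarrow> ('a, ('a, 'b) K) K" where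
  "L_comult = (\<lambda>(\<xi>, b). (\<xi>, (\<xi>, b)))"

text \<open>The multiplication \<open>K(Rf) \<rightarrow> Kf\<close> of the monad: with \<open>q : Kf \<rightarrow> QA\<close> the first projection
  and \<open>\<mu>\<close> the multiplication of \<open>Q\<close>, it is \<open>(\<zeta>, b) \<mapsto> (\<mu> (Qq \<zeta>), b)\<close>.\<close>

definition R_mult :: "'a gms \<Rightarrow> (('a, 'b) K, 'b) K \<Rightarrow> ('a, 'b) K" where
  "R_mult A = (\<lambda>(\<zeta>, b). (Q_mult A (Q_map (Q_obj A) fst \<zeta>), b))"

text \<open>The comonad has identity domain component and the monad identity codomain component, so by
  the (co)unit law a (co)algebra structure on \<open>f\<close> amounts to a map \<open>s : B \<rightarrow> Kf\<close>, respectively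
  \<open>p : Kf \<rightarrow> A\<close>. In each case the first equation says that \<open>s\<close> (or \<open>p\<close>) is a morphism in the
  arrow category, the second is the (co)unit law and the third is (co)associativity.\<close>

definition L_coalgebra :: "'a gms \<Rightarrow> 'b gms \<Rightarrow> ('a \<Rightarrow> 'b) \<Rightarrow> ('b \<Rightarrow> ('a, 'b) K) \<Rightarrow> bool" where
  "L_coalgebra A B f s \<longleftrightarrow> gms_hom B (K_obj A B f) s \<and>
     (\<forall>a\<in>pts A. s (f a) = L_map A f a) \<and>
     (\<forall>b\<in>pts B. R_map (s b) = b) \<and>
     (\<forall>b\<in>pts B. L_comult (s b) = K_map A id s (s b))"

definition R_algebra :: "'a gms \<Rightarrow> 'b gms \<Rightarrow> ('a \<Rightarrow> 'b) \<Rightarrow> (('a, 'b) K \<Rightarrow> 'a) \<Rightarrow> bool" where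
  "R_algebra A B f p \<longleftrightarrow> gms_hom (K_obj A B f) A p \<and>
     (\<forall>z\<in>pts (K_obj A B f). f (p z) = R_map z) \<and>
     (\<forall>a\<in>pts A. p (L_map A f a) = a) \<and>
     (\<forall>w\<in>pts (K_obj (K_obj A B f) B R_map). p (R_mult A w) = p (K_map A p id w))"

definition left_map :: "'a gms \<Rightarrow> 'b gms \<Rightarrow> ('a \<Rightarrow> 'b) \<Rightarrow> bool" where
  "left_map A B f \<longleftrightarrow> skeletal A \<and> skeletal B \<and> gms_hom A B f \<and> (\<exists>s. L_coalgebra A B f s)"

definition right_map :: "'a gms \<Rightarrow> 'b gms \<Rightarrow> ('a \<Rightarrow> 'b) \<Rightarrow> bool" where
  "right_map A B f \<longleftrightarrow> skeletal A \<and> skeletal B \<and> gms_hom A B f \<and> (\<exists>p. R_algebra A B f p)"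


section \<open>The induced system on metric spaces\<close>

definition met_left :: "'a gms \<Rightarrow> 'b gms \<Rightarrow> ('a \<Rightarrow> 'b) \<Rightarrow> bool" where
  "met_left A B f \<longleftrightarrow> metric_sp A \<and> metric_sp B \<and> left_map A B f"

definition met_right :: "'a gms \<Rightarrow> 'b gms \<Rightarrow> ('a \<Rightarrow> 'b) \<Rightarrow> bool" where
  "met_right A B f \<longleftrightarrow> metric_sp A \<and> metric_sp B \<and> right_map A B f"

text \<open>Every commutative square from \<open>e : A \<rightarrow> B\<close> to \<open>m : C \<rightarrow> D\<close> has a unique diagonal filler;
  extensionality turns uniqueness on \<open>pts B\<close> into uniqueness of a function.\<close>

definition orthogonal_maps ::
  "'a gms \<Rightarrow> 'b gms \<Rightarrow> ('a \<Rightarrow> 'b) \<Rightarrow> 'c gms \<Rightarrow> 'd gms \<Rightarrow> ('c \<Rightarrow> 'd) \<Rightarrow> bool" where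
  "orthogonal_maps A B e C D m \<longleftrightarrow>
     (\<forall>u v. gms_hom A C u \<and> gms_hom B D v \<and> (\<forall>a\<in>pts A. m (u a) = v (e a)) \<longrightarrow>
        (\<exists>!d. d \<in> extensional (pts B) \<and> gms_hom B C d \<and>
              (\<forall>a\<in>pts A. d (e a) = u a) \<and> (\<forall>b\<in>pts B. m (d b) = v b)))"

end

theory Submission
  imports Defs
begin

text \<open>Between metric spaces, both kinds of algebraic structure amount to properties stated with
  sequences. A point of \<open>K_obj A B f\<close> is a Cauchy sequence \<open>x\<close> of \<open>A\<close>, up to equivalence, together
  with a limit \<open>b\<close> of \<open>f x\<^sub>n\<close>. A section \<open>s\<close> of \<open>R_map\<close> thus chooses, for every \<open>b\<close>, a sequence of \<open>A\<close>
  whose image converges to \<open>b\<close>, and \<open>s \<cdot> f = L_map A f\<close> forces \<open>f\<close> to be isometric: the left maps are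
  the dense isometries. Dually, the right maps are those \<open>f\<close> for which a Cauchy sequence \<open>x\<close> converges
  over every limit of \<open>f x\<^sub>n\<close>; for \<open>R_map\<close> this is the completeness of \<open>Q_obj A\<close>. In a square from a dense
  isometry to a right map, the filler at \<open>b = lim e x\<^sub>n\<close> has to be the limit of \<open>u x\<^sub>n\<close> over \<open>v b\<close>.\<close>

section \<open>Null sequences and halving in the extended nonnegative reals\<close>

lemma ennreal_tendsto_0_iff:
  fixes f :: "nat \<Rightarrow> ennreal"
  shows "f \<longlonglongrightarrow> 0 \<longleftrightarrow> (\<forall>\<epsilon>>0. \<exists>N. \<forall>n\<ge>N. f n < \<epsilon>)"
  by (auto simp: order_tendsto_iff eventually_sequentially)

lemma ennreal_tendsto_0_le:
  fixes f g :: "nat \<Rightarrow> ennreal"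
  assumes "g \<longlonglongrightarrow> 0" "\<And>n. f n \<le> g n"
  shows "f \<longlonglongrightarrow> 0"
  using tendsto_sandwich[OF _ _ tendsto_const assms(1), of f] assms(2) by simp

lemma ennreal_half_gt_0: "0 < \<epsilon> \<Longrightarrow> 0 < \<epsilon> / (2::ennreal)"
  by (simp add: ennreal_zero_less_divide)

lemma ennreal_add_less_halves:
  fixes x y \<epsilon> :: ennreal
  assumes "x < \<epsilon> / 2" "y < \<epsilon> / 2"
  shows "x + y < \<epsilon>"
  using add_strict_mono[OF assms] by (simp add: mult_2[symmetric] ennreal_times_divide mult.commute ennreal_mult_divide_eq)

lemma inverse_of_nat_Suc_ennreal: "inverse (of_nat (Suc n)) = ennreal (inverse (real (Suc n)))"
  by (subst inverse_ennreal[symmetric]) (auto simp: ennreal_of_nat_eq_real_of_nat simp del: of_nat_Suc)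

lemma ennreal_inverse_Suc_tendsto_0: "(\<lambda>n. inverse (of_nat (Suc n)) :: ennreal) \<longlonglongrightarrow> 0"
proof -
  have "(\<lambda>n. ennreal (inverse (real (Suc n)))) \<longlonglongrightarrow> ennreal 0"
    by (intro tendsto_ennrealI LIMSEQ_inverse_real_of_nat)
  then show ?thesis
    by (simp add: inverse_of_nat_Suc_ennreal del: of_nat_Suc)
qed

section \<open>Convergence and Cauchy sequences\<close>

lemma metric_sp_self: "metric_sp A \<Longrightarrow> a \<in> pts A \<Longrightarrow> gd A a a = 0"
  and metric_sp_sym: "metric_sp A \<Longrightarrow> a \<in> pts A \<Longrightarrow> b \<in> pts A \<Longrightarrow> gd A a b = gd A b a"
  and metric_sp_triangle: "metric_sp A \<Longrightarrow> a \<in> pts A \<Longrightarrow> b \<in> pts A \<Longrightarrow> c \<in> pts A \<Longrightarrow>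
    gd A a c \<le> gd A a b + gd A b c"
  and metric_sp_eqI: "metric_sp A \<Longrightarrow> a \<in> pts A \<Longrightarrow> b \<in> pts A \<Longrightarrow> gd A a b = 0 \<Longrightarrow> a = b"
  and metric_sp_skeletal: "metric_sp A \<Longrightarrow> skeletal A"
  unfolding metric_sp_def skeletal_def gen_metric_def gms_le_def by (blast, blast, blast, metis, blast)

lemma metric_spI:
  assumes "\<And>a. a \<in> pts A \<Longrightarrow> gd A a a = 0"
    and "\<And>a b. a \<in> pts A \<Longrightarrow> b \<in> pts A \<Longrightarrow> gd A a b = gd A b a"
    and "\<And>a b c. a \<in> pts A \<Longrightarrow> b \<in> pts A \<Longrightarrow> c \<in> pts A \<Longrightarrow> gd A a c \<le> gd A a b + gd A b c"
    and "\<And>a b. a \<in> pts A \<Longrightarrow> b \<in> pts A \<Longrightarrow> gd A a b = 0 \<Longrightarrow> a = b"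
  shows "metric_sp A"
  unfolding metric_sp_def skeletal_def gen_metric_def gms_le_def using assms by blast

lemma metric_sp_quadrangle:
  assumes "metric_sp A" "a \<in> pts A" "b \<in> pts A" "a' \<in> pts A" "b' \<in> pts A"
  shows "gd A a b \<le> gd A a a' + gd A a' b' + gd A b' b"
proof -
  have "gd A a b \<le> gd A a b' + gd A b' b"
    by (intro metric_sp_triangle assms)
  also have "\<dots> \<le> gd A a a' + gd A a' b' + gd A b' b"
    by (intro add_right_mono metric_sp_triangle assms)
  finally show ?thesis .
qed

lemma gms_hom_in: "gms_hom A B f \<Longrightarrow> a \<in> pts A \<Longrightarrow> f a \<in> pts B"
  and gms_hom_le: "gms_hom A B f \<Longrightarrow> a \<in> pts A \<Longrightarrow> a' \<in> pts A \<Longrightarrow> gd B (f a) (f a') \<le> gd A a a'"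
  by (auto simp: gms_hom_def)

lemma gms_hom_comp:
  assumes f: "gms_hom A B f" and g: "gms_hom B C g"
  shows "gms_hom A C (g \<circ> f)"
  unfolding gms_hom_def
  using gms_hom_in[OF g gms_hom_in[OF f]]
    order_trans[OF gms_hom_le[OF g gms_hom_in[OF f] gms_hom_in[OF f]] gms_hom_le[OF f]] by auto

lemma isometry_in: "isometry A B f \<Longrightarrow> a \<in> pts A \<Longrightarrow> f a \<in> pts B"
  and isometry_eq: "isometry A B f \<Longrightarrow> a \<in> pts A \<Longrightarrow> a' \<in> pts A \<Longrightarrow> gd B (f a) (f a') = gd A a a'"
  and isometry_hom: "isometry A B f \<Longrightarrow> gms_hom A B f"
  by (auto simp: isometry_def gms_hom_def)

lemma gms_Cauchy_in: "gms_Cauchy A x \<Longrightarrow> x n \<in> pts A"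
  by (simp add: gms_Cauchy_def)

lemma gms_Cauchy_const: "metric_sp A \<Longrightarrow> a \<in> pts A \<Longrightarrow> gms_Cauchy A (\<lambda>_. a)"
  by (simp add: gms_Cauchy_def metric_sp_self)

lemma gms_Cauchy_hom:
  assumes f: "gms_hom A B f" and x: "gms_Cauchy A x"
  shows "gms_Cauchy B (\<lambda>n. f (x n))"
  using x gms_hom_in[OF f] gms_hom_le[OF f] unfolding gms_Cauchy_def
  by (meson order_le_less_trans)

lemma gms_Cauchy_isometryD:
  assumes f: "isometry A B f" and x: "\<And>n. x n \<in> pts A" and c: "gms_Cauchy B (\<lambda>n. f (x n))"
  shows "gms_Cauchy A x"
  using c x by (simp add: gms_Cauchy_def isometry_eq[OF f])

lemma gms_lim_in: "gms_lim A x a \<Longrightarrow> a \<in> pts A"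
  by (simp add: gms_lim_def)

lemma gms_lim_iff:
  assumes "metric_sp A" "\<And>n. x n \<in> pts A"
  shows "gms_lim A x a \<longleftrightarrow> a \<in> pts A \<and> (\<lambda>n. gd A (x n) a) \<longlonglongrightarrow> 0"
proof -
  have "(\<lambda>n. gd A a (x n)) = (\<lambda>n. gd A (x n) a)" if "a \<in> pts A"
    using metric_sp_sym[OF assms(1) that assms(2)] by blast
  then show ?thesis
    by (auto simp: gms_lim_def)
qed

lemma gms_lim_const: "metric_sp A \<Longrightarrow> a \<in> pts A \<Longrightarrow> gms_lim A (\<lambda>_. a) a"
  by (simp add: gms_lim_def metric_sp_self)

lemma gms_lim_hom:
  assumes f: "gms_hom A B f" and x: "\<And>n. x n \<in> pts A" "gms_lim A x a"
  shows "gms_lim B (\<lambda>n. f (x n)) (f a)"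
  using x(2) ennreal_tendsto_0_le[of "\<lambda>n. gd A (x n) a" "\<lambda>n. gd B (f (x n)) (f a)"]
    ennreal_tendsto_0_le[of "\<lambda>n. gd A a (x n)" "\<lambda>n. gd B (f a) (f (x n))"]
    gms_hom_in[OF f] gms_hom_le[OF f] x(1)
  by (simp add: gms_lim_def)

lemma gms_lim_Cauchy:
  assumes A: "metric_sp A" and x: "\<And>n. x n \<in> pts A" and lim: "gms_lim A x a"
  shows "gms_Cauchy A x"
  unfolding gms_Cauchy_def
proof (intro conjI allI impI x)
  fix \<epsilon> :: ennreal assume "0 < \<epsilon>"
  with lim ennreal_half_gt_0 obtain M N where
    M: "\<And>n. n \<ge> M \<Longrightarrow> gd A (x n) a < \<epsilon> / 2" and N: "\<And>n. n \<ge> N \<Longrightarrow> gd A a (x n) < \<epsilon> / 2"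
    unfolding gms_lim_def ennreal_tendsto_0_iff by meson
  have "gd A (x n) (x m) < \<epsilon>" if "n \<ge> max M N" "m \<ge> max M N" for n m
    using metric_sp_triangle[OF A x gms_lim_in[OF lim] x, of n m]
      ennreal_add_less_halves[OF M[of n] N[of m]] that by auto
  then show "\<exists>n\<^sub>0. \<forall>n\<ge>n\<^sub>0. \<forall>m\<ge>n\<^sub>0. gd A (x n) (x m) < \<epsilon>"
    by blast
qed

lemma Cauchy_equiv_iff:
  assumes "metric_sp A" "\<And>n. x n \<in> pts A" "\<And>n. y n \<in> pts A"
  shows "Cauchy_equiv A x y \<longleftrightarrow> (\<lambda>n. gd A (x n) (y n)) \<longlonglongrightarrow> 0"
  unfolding Cauchy_equiv_def using metric_sp_sym[OF assms(1) assms(2) assms(3)] by simp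

lemma Cauchy_equiv_sym: "Cauchy_equiv A x y \<Longrightarrow> Cauchy_equiv A y x"
  by (simp add: Cauchy_equiv_def)

lemma Cauchy_equiv_refl: "metric_sp A \<Longrightarrow> (\<And>n. x n \<in> pts A) \<Longrightarrow> Cauchy_equiv A x x"
  by (simp add: Cauchy_equiv_def metric_sp_self)

lemma Cauchy_equiv_trans:
  assumes A: "metric_sp A" and in_A: "\<And>n. x n \<in> pts A" "\<And>n. y n \<in> pts A" "\<And>n. z n \<in> pts A"
    and xy: "Cauchy_equiv A x y" and yz: "Cauchy_equiv A y z"
  shows "Cauchy_equiv A x z"
proof -
  have "(\<lambda>n. gd A (x n) (y n) + gd A (y n) (z n)) \<longlonglongrightarrow> 0 + 0"
    using xy yz by (intro tendsto_add) (auto simp: Cauchy_equiv_def)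
  then show ?thesis
    using metric_sp_triangle[OF A in_A] by (auto simp: Cauchy_equiv_iff[OF A] in_A intro: ennreal_tendsto_0_le)
qed

lemma Cauchy_equiv_hom:
  assumes f: "gms_hom A B f" and "\<And>n. x n \<in> pts A" "\<And>n. y n \<in> pts A" "Cauchy_equiv A x y"
  shows "Cauchy_equiv B (\<lambda>n. f (x n)) (\<lambda>n. f (y n))"
  using assms unfolding Cauchy_equiv_def
  by (auto intro: ennreal_tendsto_0_le[of "\<lambda>n. gd A (x n) (y n)"]
      ennreal_tendsto_0_le[of "\<lambda>n. gd A (y n) (x n)"] gms_hom_le[OF f])

text \<open>Since \<open>\<infinity>\<close> is a legitimate distance, real Cauchy sequences are not
  directly available. The quadrangle inequality bounds late distances by each other up to
  \<open>e\<close>, which closes the gap between limsup and liminf.\<close>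

lemma gd_Cauchy_convergent:
  assumes A: "metric_sp A" and x: "gms_Cauchy A x" and y: "gms_Cauchy A y"
  shows "\<exists>r. (\<lambda>n. gd A (x n) (y n)) \<longlonglongrightarrow> r"
proof -
  define h where "h n = gd A (x n) (y n)" for n
  have "limsup h \<le> liminf h + ennreal e" if "0 < e" for e
  proof -
    have e: "0 < ennreal e / 2"
      using that by (simp add: ennreal_half_gt_0)
    obtain M N where
      M: "\<And>n m. n \<ge> M \<Longrightarrow> m \<ge> M \<Longrightarrow> gd A (x n) (x m) < ennreal e / 2" and
      N: "\<And>n m. n \<ge> N \<Longrightarrow> m \<ge> N \<Longrightarrow> gd A (y n) (y m) < ennreal e / 2"
      using x y e unfolding gms_Cauchy_def by meson
    have *: "h n \<le> h m + ennreal e" if "n \<ge> max M N" "m \<ge> max M N" for n m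
    proof -
      have "h n \<le> gd A (x n) (x m) + h m + gd A (y m) (y n)"
        unfolding h_def using x y by (intro metric_sp_quadrangle A gms_Cauchy_in)
      also have "\<dots> = h m + (gd A (x n) (x m) + gd A (y m) (y n))"
        by (simp add: ac_simps)
      also have "\<dots> \<le> h m + ennreal e"
        using ennreal_add_less_halves[OF M[of n m] N[of m n]] that by (intro add_left_mono) auto
      finally show ?thesis .
    qed
    have "limsup h \<le> h m + ennreal e" if "m \<ge> max M N" for m
      using * that by (intro Limsup_bounded eventually_sequentiallyI[of "max M N"])
    \<comment> \<open>Subtracting the finite \<open>ennreal e\<close> isolates \<open>h m\<close>,
      so the bound passes to the liminf; this stays sound when the limsup is infinite.\<close>
    then have "limsup h - ennreal e \<le> h m" if "m \<ge> max M N" for m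
      using that by (simp add: ennreal_minus_le_iff add.commute)
    then have "limsup h - ennreal e \<le> liminf h"
      by (intro Liminf_bounded eventually_sequentiallyI[of "max M N"])
    then show ?thesis
      by (auto simp: ennreal_minus_le_iff add.commute)
  qed
  then have "limsup h \<le> liminf h"
    by (rule ennreal_le_epsilon)
  then have "h \<longlonglongrightarrow> limsup h"
    by (intro tendsto_Limsup) (auto intro!: antisym Liminf_le_Limsup)
  then show ?thesis
    unfolding h_def by blast
qed

text \<open>The outer terms of the quadrangle inequality vanish in the limit. Used in both
  directions, this makes the distance in \<open>Q_obj\<close> independent of
  representatives.\<close>

lemma gd_limit_equiv_le:
  assumes A: "metric_sp A"
    and in_A: "\<And>n. x n \<in> pts A" "\<And>n. y n \<in> pts A" "\<And>n. x' n \<in> pts A" "\<And>n. y' n \<in> pts A"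
    and eq: "Cauchy_equiv A x x'" "Cauchy_equiv A y y'"
    and r: "(\<lambda>n. gd A (x n) (y n)) \<longlonglongrightarrow> r" and r': "(\<lambda>n. gd A (x' n) (y' n)) \<longlonglongrightarrow> r'"
  shows "r \<le> r'"
proof -
  have "(\<lambda>n. gd A (x n) (x' n) + gd A (x' n) (y' n) + gd A (y' n) (y n)) \<longlonglongrightarrow> 0 + r' + 0"
    using eq r' by (intro tendsto_add) (auto simp: Cauchy_equiv_def)
  then show ?thesis
    using LIMSEQ_le[OF r] metric_sp_quadrangle[OF A in_A] by fastforce
qed

section \<open>The monad on metric spaces\<close>

lemma Q_class_memI: "metric_sp A \<Longrightarrow> gms_Cauchy A x \<Longrightarrow> x \<in> Q_class A x"
  by (simp add: Q_class_def Cauchy_equiv_refl gms_Cauchy_in)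

lemma Q_class_memD: "y \<in> Q_class A x \<Longrightarrow> gms_Cauchy A y \<and> Cauchy_equiv A x y"
  by (simp add: Q_class_def)

lemma Q_class_eqI:
  assumes A: "metric_sp A" and x: "gms_Cauchy A x" and y: "gms_Cauchy A y"
    and eq: "Cauchy_equiv A x y"
  shows "Q_class A x = Q_class A y"
proof -
  have "Cauchy_equiv A x z \<longleftrightarrow> Cauchy_equiv A y z" if "gms_Cauchy A z" for z
    using Cauchy_equiv_trans[OF A, of x y z] Cauchy_equiv_trans[OF A, of y x z]
      Cauchy_equiv_sym[OF eq] eq x y that by (auto simp: gms_Cauchy_in)
  then show ?thesis
    by (auto simp: Q_class_def)
qed

lemma pts_Q_obj: "pts (Q_obj A) = Q_class A ` Collect (gms_Cauchy A)"
  by (auto simp: Q_obj_def)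

lemma Q_class_in: "gms_Cauchy A x \<Longrightarrow> Q_class A x \<in> pts (Q_obj A)"
  by (simp add: pts_Q_obj)

text \<open>Resolves the definite description in \<open>Q_obj\<close>: existence by convergence,
  uniqueness by comparing representatives both ways.\<close>

lemma gd_Q_class:
  assumes A: "metric_sp A" and x: "gms_Cauchy A x" and y: "gms_Cauchy A y"
  shows "(\<lambda>n. gd A (x n) (y n)) \<longlonglongrightarrow> gd (Q_obj A) (Q_class A x) (Q_class A y)"
proof -
  obtain r where r: "(\<lambda>n. gd A (x n) (y n)) \<longlonglongrightarrow> r"
    using gd_Cauchy_convergent[OF A x y] by blast
  have "gd (Q_obj A) (Q_class A x) (Q_class A y) = r"
    unfolding Q_obj_def gms.simps
  proof (rule the_equality)
    show "\<exists>x'\<in>Q_class A x. \<exists>y'\<in>Q_class A y. (\<lambda>n. gd A (x' n) (y' n)) \<longlonglongrightarrow> r"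
      using r Q_class_memI[OF A] x y by blast
  next
    fix r' assume "\<exists>x'\<in>Q_class A x. \<exists>y'\<in>Q_class A y. (\<lambda>n. gd A (x' n) (y' n)) \<longlonglongrightarrow> r'"
    then obtain x' y' where "gms_Cauchy A x'" "gms_Cauchy A y'" "Cauchy_equiv A x x'"
      "Cauchy_equiv A y y'" "(\<lambda>n. gd A (x' n) (y' n)) \<longlonglongrightarrow> r'"
      using Q_class_memD by blast
    then show "r' = r"
      using gd_limit_equiv_le[OF A, of x y x' y' r r'] gd_limit_equiv_le[OF A, of x' y' x y r' r] r x y
      by (auto simp: gms_Cauchy_in Cauchy_equiv_sym intro: antisym)
  qed
  with r show ?thesis by simp
qed

lemma gd_Q_class_eqI:
  assumes "metric_sp A" "gms_Cauchy A x" "gms_Cauchy A y" "(\<lambda>n. gd A (x n) (y n)) \<longlonglongrightarrow> r"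
  shows "gd (Q_obj A) (Q_class A x) (Q_class A y) = r"
  using LIMSEQ_unique[OF gd_Q_class[OF assms(1-3)] assms(4)] .

text \<open>The axioms pass to limits of distances between representatives. For separation, a
  vanishing limit is equivalence of the representatives, one direction being enough by
  symmetry.\<close>

lemma metric_sp_Q_obj:
  assumes A: "metric_sp A"
  shows "metric_sp (Q_obj A)"
proof (rule metric_spI)
  fix \<xi> assume "\<xi> \<in> pts (Q_obj A)"
  then obtain x where x: "gms_Cauchy A x" "\<xi> = Q_class A x"
    by (auto simp: pts_Q_obj)
  then show "gd (Q_obj A) \<xi> \<xi> = 0"
    using metric_sp_self[OF A gms_Cauchy_in[OF x(1)]] by (simp add: gd_Q_class_eqI[OF A])
next
  fix \<xi> \<zeta> assume "\<xi> \<in> pts (Q_obj A)" "\<zeta> \<in> pts (Q_obj A)"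
  then obtain x y where x: "gms_Cauchy A x" "\<xi> = Q_class A x" and y: "gms_Cauchy A y" "\<zeta> = Q_class A y"
    by (auto simp: pts_Q_obj)
  note in_A = gms_Cauchy_in[OF x(1)] gms_Cauchy_in[OF y(1)]
  show "gd (Q_obj A) \<xi> \<zeta> = gd (Q_obj A) \<zeta> \<xi>"
    using gd_Q_class[OF A y(1) x(1)] metric_sp_sym[OF A in_A]
    unfolding x(2) y(2) by (intro gd_Q_class_eqI[OF A x(1) y(1)]) simp
  show "\<xi> = \<zeta>" if "gd (Q_obj A) \<xi> \<zeta> = 0"
    using that gd_Q_class[OF A x(1) y(1)] Q_class_eqI[OF A x(1) y(1)]
    by (simp add: x y Cauchy_equiv_iff[OF A in_A])
next
  fix \<xi> \<zeta> \<theta> assume "\<xi> \<in> pts (Q_obj A)" "\<zeta> \<in> pts (Q_obj A)" "\<theta> \<in> pts (Q_obj A)"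
  then obtain x y z where xyz: "gms_Cauchy A x" "gms_Cauchy A y" "gms_Cauchy A z"
    and eq: "\<xi> = Q_class A x" "\<zeta> = Q_class A y" "\<theta> = Q_class A z"
    by (auto simp: pts_Q_obj)
  have "(\<lambda>n. gd A (x n) (y n) + gd A (y n) (z n))
      \<longlonglongrightarrow> gd (Q_obj A) \<xi> \<zeta> + gd (Q_obj A) \<zeta> \<theta>"
    unfolding eq by (intro tendsto_add gd_Q_class A xyz)
  moreover have "(\<lambda>n. gd A (x n) (z n)) \<longlonglongrightarrow> gd (Q_obj A) \<xi> \<theta>"
    unfolding eq by (intro gd_Q_class A xyz)
  ultimately show "gd (Q_obj A) \<xi> \<theta> \<le> gd (Q_obj A) \<xi> \<zeta> + gd (Q_obj A) \<zeta> \<theta>"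
    using metric_sp_triangle[OF A] xyz gms_Cauchy_in by (blast intro: LIMSEQ_le)
qed

lemma Q_unit_in: "metric_sp A \<Longrightarrow> a \<in> pts A \<Longrightarrow> Q_unit A a \<in> pts (Q_obj A)"
  by (simp add: Q_unit_def Q_class_in gms_Cauchy_const)

lemma isometry_Q_unit: "metric_sp A \<Longrightarrow> isometry A (Q_obj A) (Q_unit A)"
  by (auto simp: isometry_def Q_unit_in) (auto simp: Q_unit_def gd_Q_class_eqI gms_Cauchy_const)

text \<open>Convergence to \<open>a\<close> is equivalence with the constant sequence at
  \<open>a\<close>. This trades limits in \<open>A\<close> for equalities in \<open>Q_obj A\<close>,
  which give uniqueness of limits and continuity of the distance.\<close>

lemma Q_class_eq_unit_iff:
  assumes A: "metric_sp A" and x: "gms_Cauchy A x" and a: "a \<in> pts A"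
  shows "Q_class A x = Q_unit A a \<longleftrightarrow> gms_lim A x a"
proof
  assume "Q_class A x = Q_unit A a"
  then show "gms_lim A x a"
    using Q_class_memD[of x A "\<lambda>_. a"] Q_class_memI[OF A x] a
    by (simp add: Q_unit_def gms_lim_def Cauchy_equiv_def)
next
  assume "gms_lim A x a"
  then show "Q_class A x = Q_unit A a"
    unfolding Q_unit_def
    by (intro Q_class_eqI A x gms_Cauchy_const a) (simp add: gms_lim_def Cauchy_equiv_def)
qed

lemma gms_lim_unique:
  assumes A: "metric_sp A" and x: "\<And>n. x n \<in> pts A" and lim: "gms_lim A x a" "gms_lim A x b"
  shows "a = b"
proof -
  have "Q_unit A a = Q_unit A b"
    using lim gms_lim_Cauchy[OF A x lim(1)] Q_class_eq_unit_iff[OF A] gms_lim_in by metis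
  then have "gd A a b = 0"
    using isometry_eq[OF isometry_Q_unit[OF A]] metric_sp_self[OF metric_sp_Q_obj[OF A]] lim
    by (metis A Q_unit_in gms_lim_in)
  then show ?thesis
    by (rule metric_sp_eqI[OF A lim[THEN gms_lim_in]])
qed

lemma gd_tendsto:
  assumes A: "metric_sp A" and x: "\<And>n. x n \<in> pts A" "gms_lim A x a"
    and y: "\<And>n. y n \<in> pts A" "gms_lim A y b"
  shows "(\<lambda>n. gd A (x n) (y n)) \<longlonglongrightarrow> gd A a b"
proof -
  have c: "gms_Cauchy A x" "gms_Cauchy A y"
    using gms_lim_Cauchy[OF A] x y by auto
  then have "Q_class A x = Q_unit A a" "Q_class A y = Q_unit A b"
    using x y by (simp_all add: Q_class_eq_unit_iff A gms_lim_in)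
  then show ?thesis
    using gd_Q_class[OF A c] isometry_eq[OF isometry_Q_unit[OF A]] x y by (simp add: gms_lim_in)
qed

section \<open>Density of the unit and completeness of \<open>Q_obj\<close>\<close>

lemma Q_unit_lim:
  assumes A: "metric_sp A" and x: "gms_Cauchy A x"
  shows "gms_lim (Q_obj A) (\<lambda>n. Q_unit A (x n)) (Q_class A x)"
proof -
  note in_A = gms_Cauchy_in[OF x]
  have "(\<lambda>n. gd (Q_obj A) (Q_unit A (x n)) (Q_class A x)) \<longlonglongrightarrow> 0"
    unfolding ennreal_tendsto_0_iff
  proof (intro allI impI)
    fix \<epsilon> :: ennreal assume "0 < \<epsilon>"
    \<comment> \<open>A limit weakens strict bounds; the intermediate \<open>\<delta>\<close>
      restores strictness.\<close>
    then obtain \<delta> where \<delta>: "0 < \<delta>" "\<delta> < \<epsilon>"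
      using dense by blast
    then obtain N where N: "\<And>n m. n \<ge> N \<Longrightarrow> m \<ge> N \<Longrightarrow> gd A (x n) (x m) < \<delta>"
      using x unfolding gms_Cauchy_def by meson
    have "gd (Q_obj A) (Q_unit A (x n)) (Q_class A x) < \<epsilon>" if "n \<ge> N" for n
    proof -
      have "(\<lambda>m. gd A (x n) (x m)) \<longlonglongrightarrow> gd (Q_obj A) (Q_unit A (x n)) (Q_class A x)"
        unfolding Q_unit_def by (intro gd_Q_class A x gms_Cauchy_const in_A)
      then have "gd (Q_obj A) (Q_unit A (x n)) (Q_class A x) \<le> \<delta>"
        using N that by (intro LIMSEQ_le_const2) (auto intro!: exI[of _ N] less_imp_le)
      with \<delta> show ?thesis by simp
    qed
    then show "\<exists>N. \<forall>n\<ge>N. gd (Q_obj A) (Q_unit A (x n)) (Q_class A x) < \<epsilon>"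
      by blast
  qed
  then show ?thesis
    by (simp add: gms_lim_iff metric_sp_Q_obj A Q_unit_in in_A Q_class_in x)
qed

text \<open>The epsilon form is easier to compose and to use for approximation; sequences are
  recovered by choosing points closer than \<open>1/(n+1)\<close>.\<close>

lemma dense_map_iff:
  assumes B: "metric_sp B" and f: "gms_hom A B f"
  shows "dense_map A B f \<longleftrightarrow> (\<forall>b\<in>pts B. \<forall>\<epsilon>>0. \<exists>a\<in>pts A. gd B (f a) b < \<epsilon>)"
proof (intro iffI ballI allI impI)
  fix b and \<epsilon> :: ennreal assume "dense_map A B f" "b \<in> pts B" "0 < \<epsilon>"
  then show "\<exists>a\<in>pts A. gd B (f a) b < \<epsilon>"
    unfolding dense_map_def gms_lim_def ennreal_tendsto_0_iff by (meson order_refl)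
next
  assume *: "\<forall>b\<in>pts B. \<forall>\<epsilon>>0. \<exists>a\<in>pts A. gd B (f a) b < \<epsilon>"
  show "dense_map A B f"
    unfolding dense_map_def
  proof
    fix b assume b: "b \<in> pts B"
    have "0 < inverse (of_nat (Suc n) :: ennreal)" for n
      by (simp add: inverse_of_nat_Suc_ennreal del: of_nat_Suc)
    then have "\<exists>a. a \<in> pts A \<and> gd B (f a) b < inverse (of_nat (Suc n))" for n
      using * b by blast
    then obtain x where x: "\<And>n. x n \<in> pts A" "\<And>n. gd B (f (x n)) b < inverse (of_nat (Suc n))"
      using choice[of "\<lambda>n a. a \<in> pts A \<and> gd B (f a) b < inverse (of_nat (Suc n))"] by blast
    have "(\<lambda>n. gd B (f (x n)) b) \<longlonglongrightarrow> 0"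
      by (rule ennreal_tendsto_0_le[OF ennreal_inverse_Suc_tendsto_0]) (rule less_imp_le[OF x(2)])
    then have "gms_lim B (\<lambda>n. f (x n)) b"
      using b gms_hom_in[OF f] x(1) by (simp add: gms_lim_iff[OF B])
    with x show "\<exists>x. (\<forall>n. x n \<in> pts A) \<and> gms_lim B (\<lambda>n. f (x n)) b"
      by blast
  qed
qed

lemma dense_Q_unit:
  assumes A: "metric_sp A"
  shows "dense_map A (Q_obj A) (Q_unit A)"
  unfolding dense_map_def
proof
  fix \<xi> assume "\<xi> \<in> pts (Q_obj A)"
  then obtain x where "gms_Cauchy A x" "\<xi> = Q_class A x"
    by (auto simp: pts_Q_obj)
  then show "\<exists>x. (\<forall>n. x n \<in> pts A) \<and> gms_lim (Q_obj A) (\<lambda>n. Q_unit A (x n)) \<xi>"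
    using Q_unit_lim[OF A] gms_Cauchy_in by blast
qed

lemma gms_lim_isometry_iff:
  assumes f: "isometry A B f" and x: "\<And>n. x n \<in> pts A" and a: "a \<in> pts A"
  shows "gms_lim B (\<lambda>n. f (x n)) (f a) \<longleftrightarrow> gms_lim A x a"
  by (simp add: gms_lim_def isometry_eq[OF f] isometry_in[OF f] x a)

lemma gms_lim_Cauchy_equiv:
  assumes A: "metric_sp A" and in_A: "\<And>n. x n \<in> pts A" "\<And>n. y n \<in> pts A"
    and xy: "Cauchy_equiv A x y" and lim: "gms_lim A x a"
  shows "gms_lim A y a"
proof -
  have "Cauchy_equiv A y (\<lambda>_. a)"
    using Cauchy_equiv_trans[OF A in_A(2,1) _ Cauchy_equiv_sym[OF xy], of "\<lambda>_. a"] lim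
    by (simp add: gms_lim_def Cauchy_equiv_def)
  then show ?thesis
    using lim by (simp add: gms_lim_def Cauchy_equiv_def)
qed

lemma gms_Cauchy_Cauchy_equiv:
  assumes A: "metric_sp A" and y: "\<And>n. y n \<in> pts A" and x: "gms_Cauchy A x"
    and eq: "Cauchy_equiv A x y"
  shows "gms_Cauchy A y"
  unfolding gms_Cauchy_def
proof (intro conjI allI impI y)
  fix \<epsilon> :: ennreal assume "0 < \<epsilon>"
  \<comment> \<open>The three error terms get a quarter, a quarter and a half, so that the halving
    lemma applies twice.\<close>
  note \<epsilon> = ennreal_half_gt_0[OF this] ennreal_half_gt_0[OF ennreal_half_gt_0[OF this]]
  obtain M where M: "\<And>n m. n \<ge> M \<Longrightarrow> m \<ge> M \<Longrightarrow> gd A (x n) (x m) < \<epsilon> / 2 / 2"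
    using x \<epsilon> unfolding gms_Cauchy_def by meson
  obtain N where N: "\<And>n. n \<ge> N \<Longrightarrow> gd A (y n) (x n) < \<epsilon> / 2 / 2"
    using eq \<epsilon> unfolding Cauchy_equiv_def ennreal_tendsto_0_iff by meson
  obtain N' where N': "\<And>n. n \<ge> N' \<Longrightarrow> gd A (x n) (y n) < \<epsilon> / 2"
    using eq \<epsilon> unfolding Cauchy_equiv_def ennreal_tendsto_0_iff by meson
  have "gd A (y n) (y m) < \<epsilon>" if "n \<ge> max M (max N N')" "m \<ge> max M (max N N')" for n m
  proof -
    have "gd A (y n) (y m) \<le> gd A (y n) (x n) + gd A (x n) (x m) + gd A (x m) (y m)"
      by (intro metric_sp_quadrangle A y gms_Cauchy_in[OF x])
    also have "\<dots> < \<epsilon>"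
      using that by (intro ennreal_add_less_halves M N N') auto
    finally show ?thesis .
  qed
  then show "\<exists>n\<^sub>0. \<forall>n\<ge>n\<^sub>0. \<forall>m\<ge>n\<^sub>0. gd A (y n) (y m) < \<epsilon>"
    by blast
qed

text \<open>Diagonal argument: approximate each \<open>X n\<close> by the unit at a point
  \<open>x n\<close>, ever more closely. The units are then equivalent to \<open>X\<close>, hence
  Cauchy, so \<open>x\<close> is Cauchy because the unit is isometric, and its class is the
  limit.\<close>

lemma Q_obj_complete:
  assumes A: "metric_sp A" and X: "gms_Cauchy (Q_obj A) X"
  shows "\<exists>\<xi>. gms_lim (Q_obj A) X \<xi>"
proof -
  note Q = metric_sp_Q_obj[OF A] and u = isometry_Q_unit[OF A] and X_in = gms_Cauchy_in[OF X]
  have "\<exists>a. a \<in> pts A \<and> gd (Q_obj A) (Q_unit A a) (X n) < inverse (of_nat (Suc n))" for n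
  proof -
    have "0 < inverse (of_nat (Suc n) :: ennreal)"
      by (simp add: inverse_of_nat_Suc_ennreal del: of_nat_Suc)
    then show ?thesis
      using dense_Q_unit[OF A] X_in[of n] dense_map_iff[OF Q isometry_hom[OF u]] by blast
  qed
  then obtain x where x: "\<And>n. x n \<in> pts A"
    and xX: "\<And>n. gd (Q_obj A) (Q_unit A (x n)) (X n) < inverse (of_nat (Suc n))"
    using choice[of "\<lambda>n a. a \<in> pts A \<and> gd (Q_obj A) (Q_unit A a) (X n) < inverse (of_nat (Suc n))"]
    by blast
  have ux: "Q_unit A (x n) \<in> pts (Q_obj A)" for n
    by (rule Q_unit_in[OF A x])
  have "(\<lambda>n. gd (Q_obj A) (Q_unit A (x n)) (X n)) \<longlonglongrightarrow> 0"
    by (rule ennreal_tendsto_0_le[OF ennreal_inverse_Suc_tendsto_0]) (rule less_imp_le[OF xX])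
  then have eq: "Cauchy_equiv (Q_obj A) (\<lambda>n. Q_unit A (x n)) X"
    by (simp add: Cauchy_equiv_iff[OF Q ux X_in])
  have "gms_Cauchy (Q_obj A) (\<lambda>n. Q_unit A (x n))"
    by (rule gms_Cauchy_Cauchy_equiv[OF Q ux X Cauchy_equiv_sym[OF eq]])
  then have "gms_Cauchy A x"
    by (rule gms_Cauchy_isometryD[OF u x])
  then have "gms_lim (Q_obj A) X (Q_class A x)"
    by (intro gms_lim_Cauchy_equiv[OF Q ux X_in eq] Q_unit_lim A)
  then show ?thesis ..
qed

section \<open>Functoriality of \<open>Q\<close> and its multiplication on units\<close>

lemma Q_map_class:
  assumes A: "metric_sp A" and B: "metric_sp B" and f: "gms_hom A B f" and x: "gms_Cauchy A x"
  shows "Q_map B f (Q_class A x) = Q_class B (\<lambda>n. f (x n))"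
proof -
  \<comment> \<open>Every representative contributes the same class, so the union in
    \<open>Q_map\<close> collapses.\<close>
  have "Q_class B (\<lambda>n. f (y n)) = Q_class B (\<lambda>n. f (x n))" if "y \<in> Q_class A x" for y
    using that x f
    by (intro Q_class_eqI B gms_Cauchy_hom[OF f] Cauchy_equiv_hom[OF f])
      (auto dest!: Q_class_memD intro: Cauchy_equiv_sym simp: gms_Cauchy_in)
  then show ?thesis
    using Q_class_memI[OF A x] unfolding Q_map_def by blast
qed

lemma Q_map_unit:
  assumes "metric_sp A" "metric_sp B" "gms_hom A B f" "a \<in> pts A"
  shows "Q_map B f (Q_unit A a) = Q_unit B (f a)"
  using assms by (simp add: Q_unit_def Q_map_class gms_Cauchy_const)

lemma gms_hom_Q_map:
  assumes A: "metric_sp A" and B: "metric_sp B" and f: "gms_hom A B f"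
  shows "gms_hom (Q_obj A) (Q_obj B) (Q_map B f)"
  unfolding gms_hom_def
proof (intro conjI Pi_I ballI)
  fix \<xi> assume "\<xi> \<in> pts (Q_obj A)"
  then obtain x where x: "gms_Cauchy A x" "\<xi> = Q_class A x"
    by (auto simp: pts_Q_obj)
  then show "Q_map B f \<xi> \<in> pts (Q_obj B)"
    by (simp add: Q_map_class[OF A B f] Q_class_in gms_Cauchy_hom[OF f])
  fix \<zeta> assume "\<zeta> \<in> pts (Q_obj A)"
  then obtain y where y: "gms_Cauchy A y" "\<zeta> = Q_class A y"
    by (auto simp: pts_Q_obj)
  have "(\<lambda>n. gd B (f (x n)) (f (y n))) \<longlonglongrightarrow> gd (Q_obj B) (Q_map B f \<xi>) (Q_map B f \<zeta>)"
    using x y by (simp add: Q_map_class[OF A B f] gd_Q_class[OF B] gms_Cauchy_hom[OF f])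
  moreover have "(\<lambda>n. gd A (x n) (y n)) \<longlonglongrightarrow> gd (Q_obj A) \<xi> \<zeta>"
    using x y by (simp add: gd_Q_class[OF A])
  ultimately show "gd (Q_obj B) (Q_map B f \<xi>) (Q_map B f \<zeta>) \<le> gd (Q_obj A) \<xi> \<zeta>"
    by (rule LIMSEQ_le) (use x y gms_hom_le[OF f] gms_Cauchy_in in blast)
qed

lemma Q_map_id:
  assumes A: "metric_sp A" and \<xi>: "\<xi> \<in> pts (Q_obj A)"
  shows "Q_map A id \<xi> = \<xi>"
proof -
  have "gms_hom A A id"
    by (simp add: gms_hom_def)
  with \<xi> show ?thesis
    by (auto simp: pts_Q_obj Q_map_class[OF A A])
qed

text \<open>Associativity of the algebras constructed below evaluates the multiplication at such
  points. Every representative of the unit class converges to \<open>\<xi>\<close>, and limits are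
  unique.\<close>

lemma Q_mult_unit:
  assumes A: "metric_sp A" and \<xi>: "\<xi> \<in> pts (Q_obj A)"
  shows "Q_mult A (Q_unit (Q_obj A) \<xi>) = \<xi>"
  unfolding Q_mult_def
proof (rule the_equality)
  note Q = metric_sp_Q_obj[OF A]
  show "\<exists>X\<in>Q_unit (Q_obj A) \<xi>. gms_lim (Q_obj A) X \<xi>"
    unfolding Q_unit_def using Q_class_memI[OF Q gms_Cauchy_const[OF Q \<xi>]] gms_lim_const[OF Q \<xi>] by blast
  fix \<zeta> assume "\<exists>X\<in>Q_unit (Q_obj A) \<xi>. gms_lim (Q_obj A) X \<zeta>"
  then obtain X where X: "X \<in> Q_unit (Q_obj A) \<xi>" "gms_lim (Q_obj A) X \<zeta>"
    by blast
  then have "gms_Cauchy (Q_obj A) X" "gms_lim (Q_obj A) X \<xi>"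
    using \<xi> by (auto simp: Q_unit_def gms_lim_def Cauchy_equiv_def dest: Q_class_memD)
  with X show "\<zeta> = \<xi>"
    using gms_lim_unique[OF Q, of X] gms_Cauchy_in by blast
qed

section \<open>The factorisation\<close>

text \<open>For symmetric distances the order on \<open>Q_obj B\<close> is equality, so the comma
  object is a pullback; this is where laxness disappears.\<close>

lemma K_obj_iff_unit:
  assumes A: "metric_sp A" and B: "metric_sp B" and f: "gms_hom A B f"
  shows "z \<in> pts (K_obj A B f) \<longleftrightarrow>
    fst z \<in> pts (Q_obj A) \<and> snd z \<in> pts B \<and> Q_map B f (fst z) = Q_unit B (snd z)"
proof -
  note QB = metric_sp_Q_obj[OF B]
  have "gd (Q_obj B) (Q_map B f \<xi>) (Q_unit B b) = 0 \<longleftrightarrow> Q_map B f \<xi> = Q_unit B b"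
    if "\<xi> \<in> pts (Q_obj A)" "b \<in> pts B" for \<xi> b
    using metric_sp_eqI[OF QB] metric_sp_self[OF QB Q_unit_in[OF B that(2)]]
      gms_hom_in[OF gms_hom_Q_map[OF A B f] that(1)] Q_unit_in[OF B that(2)] by metis
  then show ?thesis
    by (cases z) (auto simp: K_obj_def gms_le_def)
qed

lemma K_obj_class_iff:
  assumes A: "metric_sp A" and B: "metric_sp B" and f: "gms_hom A B f" and x: "gms_Cauchy A x"
  shows "(Q_class A x, b) \<in> pts (K_obj A B f) \<longleftrightarrow> gms_lim B (\<lambda>n. f (x n)) b"
  using gms_Cauchy_hom[OF f x] Q_class_eq_unit_iff[OF B, of "\<lambda>n. f (x n)" b]
  by (auto simp: K_obj_iff_unit[OF A B f] Q_map_class[OF A B f x] Q_class_in x gms_lim_in)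

lemma K_obj_cases:
  assumes A: "metric_sp A" and B: "metric_sp B" and f: "gms_hom A B f"
    and z: "z \<in> pts (K_obj A B f)"
  obtains x b where "z = (Q_class A x, b)" "gms_Cauchy A x" "gms_lim B (\<lambda>n. f (x n)) b"
  using z K_obj_iff_unit[OF A B f, of z] K_obj_class_iff[OF A B f, of _ "snd z"]
  by (cases z) (auto simp: pts_Q_obj)

lemma R_map_in: "z \<in> pts (K_obj A B f) \<Longrightarrow> R_map z \<in> pts B"
  by (auto simp: K_obj_def R_map_def)

lemma gms_hom_R_map: "gms_hom (K_obj A B f) B R_map"
  by (auto simp: K_obj_def R_map_def gms_hom_def)

text \<open>As \<open>f\<close> is non-expansive, the distance in \<open>B\<close> never exceeds the one in \<open>Q_obj A\<close>.\<close>

lemma isometry_K_obj_fst: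
  assumes A: "metric_sp A" and B: "metric_sp B" and f: "gms_hom A B f"
  shows "isometry (K_obj A B f) (Q_obj A) fst"
proof -
  have "gd (Q_obj A) (fst z) (fst z') = gd (K_obj A B f) z z'"
    if "z \<in> pts (K_obj A B f)" "z' \<in> pts (K_obj A B f)" for z z'
  proof -
    from that have *: "fst z \<in> pts (Q_obj A)" "fst z' \<in> pts (Q_obj A)" "snd z \<in> pts B" "snd z' \<in> pts B"
      "Q_map B f (fst z) = Q_unit B (snd z)" "Q_map B f (fst z') = Q_unit B (snd z')"
      using K_obj_iff_unit[OF A B f, of z] K_obj_iff_unit[OF A B f, of z']
      by auto
    then have "gd B (snd z) (snd z') \<le> gd (Q_obj A) (fst z) (fst z')"
      using gms_hom_le[OF gms_hom_Q_map[OF A B f], of "fst z" "fst z'"]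
        isometry_eq[OF isometry_Q_unit[OF B]] by simp
    then show ?thesis
      by (simp add: K_obj_def case_prod_beta max_def)
  qed
  moreover have "fst z \<in> pts (Q_obj A)" if "z \<in> pts (K_obj A B f)" for z
    using that by (auto simp: K_obj_def)
  ultimately show ?thesis
    by (simp add: isometry_def)
qed

text \<open>The unit of \<open>B\<close> is isometric, hence injective, so the first component
  determines the second.\<close>

lemma K_obj_eqI:
  assumes A: "metric_sp A" and B: "metric_sp B" and f: "gms_hom A B f"
    and z: "z \<in> pts (K_obj A B f)" "z' \<in> pts (K_obj A B f)" and eq: "fst z = fst z'"
  shows "z = z'"
proof -
  have *: "snd z \<in> pts B" "snd z' \<in> pts B" "Q_unit B (snd z) = Q_unit B (snd z')"
    using z eq K_obj_iff_unit[OF A B f, of z] K_obj_iff_unit[OF A B f, of z']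
    by auto
  then have "gd B (snd z) (snd z') = 0"
    using isometry_eq[OF isometry_Q_unit[OF B]] metric_sp_self[OF metric_sp_Q_obj[OF B]]
      Q_unit_in[OF B] by metis
  with * eq show ?thesis
    using metric_sp_eqI[OF B] by (simp add: prod_eq_iff)
qed

text \<open>\<open>fst\<close> is isometric and, by \<open>K_obj_eqI\<close>, injective, so every
  axiom is pulled back from \<open>Q_obj A\<close>.\<close>

lemma metric_sp_K_obj:
  assumes A: "metric_sp A" and B: "metric_sp B" and f: "gms_hom A B f"
  shows "metric_sp (K_obj A B f)"
proof (rule metric_spI)
  note Q = metric_sp_Q_obj[OF A] and iso = isometry_K_obj_fst[OF A B f]
  note in_Q = isometry_in[OF iso] and eq = isometry_eq[OF iso, symmetric]
  show "gd (K_obj A B f) z z = 0" if "z \<in> pts (K_obj A B f)" for z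
    using that by (simp add: eq metric_sp_self[OF Q] in_Q)
  show "gd (K_obj A B f) z z' = gd (K_obj A B f) z' z"
    if "z \<in> pts (K_obj A B f)" "z' \<in> pts (K_obj A B f)" for z z'
    using that by (simp add: eq metric_sp_sym[OF Q in_Q in_Q])
  show "gd (K_obj A B f) z z'' \<le> gd (K_obj A B f) z z' + gd (K_obj A B f) z' z''"
    if "z \<in> pts (K_obj A B f)" "z' \<in> pts (K_obj A B f)" "z'' \<in> pts (K_obj A B f)" for z z' z''
    using that by (simp add: eq metric_sp_triangle[OF Q] in_Q)
  show "z = z'" if "z \<in> pts (K_obj A B f)" "z' \<in> pts (K_obj A B f)" "gd (K_obj A B f) z z' = 0" for z z'
    using that metric_sp_eqI[OF Q in_Q in_Q, of z z'] by (intro K_obj_eqI[OF A B f]) (simp_all add: eq)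
qed

lemma isometry_L_map:
  assumes A: "metric_sp A" and B: "metric_sp B" and f: "gms_hom A B f"
  shows "isometry A (K_obj A B f) (L_map A f)"
proof -
  have "L_map A f a \<in> pts (K_obj A B f)" if "a \<in> pts A" for a
    using that by (simp add: L_map_def K_obj_iff_unit[OF A B f] Q_unit_in A Q_map_unit[OF A B f] gms_hom_in[OF f])
  then show ?thesis
    using isometry_eq[OF isometry_K_obj_fst[OF A B f], symmetric] isometry_eq[OF isometry_Q_unit[OF A]]
    by (simp add: isometry_def L_map_def)
qed

text \<open>The isometry \<open>fst\<close> reflects limits and reduces the claim to
  \<open>Q_unit_lim\<close>. It serves both the density of \<open>L_map\<close> and the lifting
  property of algebras.\<close>

lemma L_map_lim:
  assumes A: "metric_sp A" and B: "metric_sp B" and f: "gms_hom A B f"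
    and x: "gms_Cauchy A x" and b: "gms_lim B (\<lambda>n. f (x n)) b"
  shows "gms_lim (K_obj A B f) (\<lambda>n. L_map A f (x n)) (Q_class A x, b)"
proof -
  have "gms_lim (Q_obj A) (\<lambda>n. fst (L_map A f (x n))) (fst (Q_class A x, b))"
    by (simp add: L_map_def Q_unit_lim A x)
  then show ?thesis
    by (subst (asm) gms_lim_isometry_iff[OF isometry_K_obj_fst[OF A B f]])
      (use b in \<open>auto simp: K_obj_class_iff[OF A B f x] isometry_in[OF isometry_L_map[OF A B f]] gms_Cauchy_in[OF x]\<close>)
qed

lemma dense_L_map:
  assumes A: "metric_sp A" and B: "metric_sp B" and f: "gms_hom A B f"
  shows "dense_map A (K_obj A B f) (L_map A f)"
  unfolding dense_map_def
proof
  fix z assume "z \<in> pts (K_obj A B f)"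
  then show "\<exists>x. (\<forall>n. x n \<in> pts A) \<and> gms_lim (K_obj A B f) (\<lambda>n. L_map A f (x n)) z"
    by (rule K_obj_cases[OF A B f]) (use L_map_lim[OF A B f] gms_Cauchy_in in blast)
qed

section \<open>Left maps\<close>

lemma L_coalgebra_imp_dense_isometry:
  assumes A: "metric_sp A" and B: "metric_sp B" and f: "gms_hom A B f" and s: "L_coalgebra A B f s"
  shows "isometry A B f" "dense_map A B f"
proof -
  have s_hom: "gms_hom B (K_obj A B f) s"
    and sf: "\<And>a. a \<in> pts A \<Longrightarrow> s (f a) = L_map A f a"
    and Rs: "\<And>b. b \<in> pts B \<Longrightarrow> R_map (s b) = b"
    using s by (auto simp: L_coalgebra_def)
  \<comment> \<open>Neither \<open>f\<close> nor \<open>s\<close> increases distances, while their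
    composite \<open>L_map A f\<close> preserves them.\<close>
  have "gd B (f a) (f a') = gd A a a'" if "a \<in> pts A" "a' \<in> pts A" for a a'
    using gms_hom_le[OF s_hom, of "f a" "f a'"] gms_hom_le[OF f, of a a'] that
    by (simp add: sf gms_hom_in[OF f] isometry_eq[OF isometry_L_map[OF A B f]])
  then show "isometry A B f"
    using gms_hom_in[OF f] by (simp add: isometry_def)
  show "dense_map A B f"
    unfolding dense_map_def
  proof
    fix b assume b: "b \<in> pts B"
    obtain x where "s b = (Q_class A x, b)" "gms_Cauchy A x" "gms_lim B (\<lambda>n. f (x n)) b"
      using Rs[OF b] by (auto simp: R_map_def intro: K_obj_cases[OF A B f gms_hom_in[OF s_hom b]])
    then show "\<exists>x. (\<forall>n. x n \<in> pts A) \<and> gms_lim B (\<lambda>n. f (x n)) b"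
      using gms_Cauchy_in by blast
  qed
qed

lemma dense_isometry_Cauchy:
  assumes B: "metric_sp B" and f: "isometry A B f" "dense_map A B f" and b: "b \<in> pts B"
  obtains x where "gms_Cauchy A x" "gms_lim B (\<lambda>n. f (x n)) b"
proof -
  obtain x where x: "\<And>n. x n \<in> pts A" "gms_lim B (\<lambda>n. f (x n)) b"
    using f(2) b unfolding dense_map_def by blast
  then have "gms_Cauchy A x"
    by (intro gms_Cauchy_isometryD[OF f(1)] gms_lim_Cauchy[OF B]) (auto simp: isometry_in[OF f(1)])
  with x that show ?thesis by blast
qed

lemma dense_isometry_imp_L_coalgebra:
  assumes A: "metric_sp A" and B: "metric_sp B" and f: "isometry A B f" "dense_map A B f"
  shows "\<exists>s. L_coalgebra A B f s"
proof -
  note f_hom = isometry_hom[OF f(1)]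
  have "\<exists>x. gms_Cauchy A x \<and> gms_lim B (\<lambda>n. f (x n)) b" if "b \<in> pts B" for b
    using dense_isometry_Cauchy[OF B f that] by blast
  then obtain x where x: "\<And>b. b \<in> pts B \<Longrightarrow> gms_Cauchy A (x b)"
    and lim: "\<And>b. b \<in> pts B \<Longrightarrow> gms_lim B (\<lambda>n. f (x b n)) b"
    using bchoice[of "pts B" "\<lambda>b x. gms_Cauchy A x \<and> gms_lim B (\<lambda>n. f (x n)) b"] by blast
  \<comment> \<open>Since \<open>f\<close> is isometric, any two choices of \<open>x b\<close> are
    equivalent, so \<open>s b\<close> does not depend on the choice.\<close>
  define s where "s b = (Q_class A (x b), b)" for b
  have s_in: "s b \<in> pts (K_obj A B f)" if "b \<in> pts B" for b
    by (simp add: s_def K_obj_class_iff[OF A B f_hom x[OF that]] lim that)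
  have s_hom: "gms_hom B (K_obj A B f) s"
    unfolding gms_hom_def
  proof (intro conjI Pi_I ballI)
    fix b b' assume b: "b \<in> pts B" "b' \<in> pts B"
    \<comment> \<open>Isometry of \<open>f\<close> carries this limit back to \<open>A\<close>, so
      \<open>s\<close> in fact preserves distances.\<close>
    have "(\<lambda>n. gd B (f (x b n)) (f (x b' n))) \<longlonglongrightarrow> gd B b b'"
      using b by (intro gd_tendsto B lim) (auto intro: isometry_in[OF f(1)] gms_Cauchy_in[OF x])
    then have "(\<lambda>n. gd A (x b n) (x b' n)) \<longlonglongrightarrow> gd B b b'"
      using b by (simp add: isometry_eq[OF f(1)] gms_Cauchy_in[OF x])
    then have "gd (Q_obj A) (Q_class A (x b)) (Q_class A (x b')) = gd B b b'"
      using b by (intro gd_Q_class_eqI A x)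
    then show "gd (K_obj A B f) (s b) (s b') \<le> gd B b b'"
      using isometry_eq[OF isometry_K_obj_fst[OF A B f_hom] s_in s_in] b by (simp add: s_def)
  qed (rule s_in)
  have "s (f a) = L_map A f a" if a: "a \<in> pts A" for a
  proof -
    note fa = isometry_in[OF f(1) a]
    \<comment> \<open>The sequence chosen for \<open>f a\<close> need not be constant, but an
      isometry reflects its convergence, so its class is the unit at \<open>a\<close>.\<close>
    have "gms_lim A (x (f a)) a"
      using gms_lim_isometry_iff[OF f(1) gms_Cauchy_in[OF x[OF fa]] a] lim[OF fa] by simp
    then show ?thesis
      by (simp add: s_def L_map_def Q_class_eq_unit_iff A x fa a)
  qed
  moreover have "L_comult (s b) = K_map A id s (s b)" if "b \<in> pts B" for b
    by (simp add: s_def L_comult_def K_map_def Q_map_id A Q_class_in x that)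
  ultimately have "L_coalgebra A B f s"
    unfolding L_coalgebra_def using s_hom by (simp add: s_def R_map_def)
  then show ?thesis by blast
qed

lemma met_left_iff:
  "met_left A B f \<longleftrightarrow> metric_sp A \<and> metric_sp B \<and> isometry A B f \<and> dense_map A B f"
proof
  assume "met_left A B f"
  then show "metric_sp A \<and> metric_sp B \<and> isometry A B f \<and> dense_map A B f"
    using L_coalgebra_imp_dense_isometry by (auto simp: met_left_def left_map_def)
next
  assume "metric_sp A \<and> metric_sp B \<and> isometry A B f \<and> dense_map A B f"
  then show "met_left A B f"
    using dense_isometry_imp_L_coalgebra
    by (auto simp: met_left_def left_map_def metric_sp_skeletal isometry_hom)
qed

text \<open>For density, approximate \<open>c\<close> from \<open>B\<close> and then the approximant
  from \<open>A\<close>; \<open>g\<close> does not enlarge the second error.\<close>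

lemma met_left_comp:
  assumes f: "met_left A B f" and g: "met_left B C g"
  shows "met_left A C (g \<circ> f)"
proof -
  from f g have A: "metric_sp A" and B: "metric_sp B" and C: "metric_sp C"
    and fi: "isometry A B f" and fd: "dense_map A B f"
    and gi: "isometry B C g" and gd: "dense_map B C g"
    by (auto simp: met_left_iff)
  note in_C = isometry_in[OF gi] isometry_in[OF gi isometry_in[OF fi]]
  have i: "isometry A C (g \<circ> f)"
    unfolding isometry_def by (auto simp: in_C isometry_in[OF fi] isometry_eq[OF gi] isometry_eq[OF fi])
  have "\<exists>a\<in>pts A. gd C (g (f a)) c < \<epsilon>" if c: "c \<in> pts C" and \<epsilon>: "0 < \<epsilon>" for c \<epsilon>
  proof -
    obtain b where b: "b \<in> pts B" "gd C (g b) c < \<epsilon> / 2"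
      using gd c ennreal_half_gt_0[OF \<epsilon>] dense_map_iff[OF C isometry_hom[OF gi]] by blast
    obtain a where a: "a \<in> pts A" "gd B (f a) b < \<epsilon> / 2"
      using fd b(1) ennreal_half_gt_0[OF \<epsilon>] dense_map_iff[OF B isometry_hom[OF fi]] by blast
    have "gd C (g (f a)) c \<le> gd C (g (f a)) (g b) + gd C (g b) c"
      using a b c by (intro metric_sp_triangle C in_C)
    also have "\<dots> < \<epsilon>"
      using a b by (intro ennreal_add_less_halves) (simp_all add: isometry_eq[OF gi] isometry_in[OF fi])
    finally show ?thesis
      using a by blast
  qed
  then have "dense_map A C (g \<circ> f)"
    by (simp add: dense_map_iff[OF C isometry_hom[OF i]])
  with i A C show ?thesis
    by (simp add: met_left_iff)
qed

section \<open>Right maps\<close>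

text \<open>Uniqueness of \<open>a\<close> is left to uniqueness of limits. Over a one-point
  \<open>B\<close> the property is completeness of \<open>A\<close>.\<close>

definition Cauchy_lifting :: "'a gms \<Rightarrow> 'b gms \<Rightarrow> ('a \<Rightarrow> 'b) \<Rightarrow> bool" where
  "Cauchy_lifting A B f \<longleftrightarrow> (\<forall>x b. gms_Cauchy A x \<and> gms_lim B (\<lambda>n. f (x n)) b \<longrightarrow>
     (\<exists>a. gms_lim A x a \<and> f a = b))"

lemma Cauchy_liftingE:
  assumes "Cauchy_lifting A B f" "gms_Cauchy A x" "gms_lim B (\<lambda>n. f (x n)) b"
  obtains a where "gms_lim A x a" "f a = b"
  using assms unfolding Cauchy_lifting_def by blast

text \<open>The non-expansive \<open>p\<close> preserves the limit in \<open>L_map_lim\<close>, and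
  its unit law turns the image sequence back into \<open>x\<close>.\<close>

lemma R_algebra_imp_Cauchy_lifting:
  assumes A: "metric_sp A" and B: "metric_sp B" and f: "gms_hom A B f" and p: "R_algebra A B f p"
  shows "Cauchy_lifting A B f"
  unfolding Cauchy_lifting_def
proof (intro allI impI, elim conjE)
  fix x b assume x: "gms_Cauchy A x" and b: "gms_lim B (\<lambda>n. f (x n)) b"
  have p_hom: "gms_hom (K_obj A B f) A p"
    and fp: "\<And>z. z \<in> pts (K_obj A B f) \<Longrightarrow> f (p z) = R_map z"
    and pL: "\<And>a. a \<in> pts A \<Longrightarrow> p (L_map A f a) = a"
    using p by (auto simp: R_algebra_def)
  have "gms_lim A (\<lambda>n. p (L_map A f (x n))) (p (Q_class A x, b))"
    by (intro gms_lim_hom[OF p_hom] isometry_in[OF isometry_L_map[OF A B f]] L_map_lim A B f x b gms_Cauchy_in)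
  then have "gms_lim A x (p (Q_class A x, b))"
    by (simp add: pL gms_Cauchy_in[OF x])
  moreover have "f (p (Q_class A x, b)) = b"
    using b fp by (simp add: K_obj_class_iff[OF A B f x] R_map_def)
  ultimately show "\<exists>a. gms_lim A x a \<and> f a = b"
    by blast
qed

text \<open>If \<open>x\<close> has the lifted limit \<open>a\<close>, its class is
  \<open>Q_unit A a\<close>, so passing to \<open>K_obj A B f\<close> adds no new points.\<close>

lemma Cauchy_lifting_surj_L_map:
  assumes A: "metric_sp A" and B: "metric_sp B" and f: "gms_hom A B f"
    and lift: "Cauchy_lifting A B f" and z: "z \<in> pts (K_obj A B f)"
  shows "z \<in> L_map A f ` pts A"
proof -
  obtain x b where x: "z = (Q_class A x, b)" "gms_Cauchy A x" "gms_lim B (\<lambda>n. f (x n)) b"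
    by (rule K_obj_cases[OF A B f z])
  obtain a where a: "gms_lim A x a" "f a = b"
    by (rule Cauchy_liftingE[OF lift x(2,3)])
  then have "z = L_map A f a"
    by (simp add: x L_map_def Q_class_eq_unit_iff A gms_lim_in)
  with a show ?thesis
    by (simp add: gms_lim_in)
qed

text \<open>First components converge because \<open>Q_obj A\<close> is complete; that their limit
  lies over \<open>b\<close> follows from uniqueness of limits in \<open>Q_obj B\<close>.\<close>

lemma Cauchy_lifting_R_map:
  assumes A: "metric_sp A" and B: "metric_sp B" and f: "gms_hom A B f"
  shows "Cauchy_lifting (K_obj A B f) B R_map"
  unfolding Cauchy_lifting_def
proof (intro allI impI, elim conjE)
  fix Z b assume Z: "gms_Cauchy (K_obj A B f) Z" and b: "gms_lim B (\<lambda>n. R_map (Z n)) b"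
  note iso = isometry_K_obj_fst[OF A B f] and Q = metric_sp_Q_obj[OF A] and QB = metric_sp_Q_obj[OF B]
  note Z_in = gms_Cauchy_in[OF Z]
  note fst_in = isometry_in[OF iso Z_in]
  obtain \<xi> where \<xi>: "gms_lim (Q_obj A) (\<lambda>n. fst (Z n)) \<xi>"
    using Q_obj_complete[OF A gms_Cauchy_hom[OF isometry_hom[OF iso] Z]] by blast
  have "gms_lim (Q_obj B) (\<lambda>n. Q_map B f (fst (Z n))) (Q_map B f \<xi>)"
    by (rule gms_lim_hom[OF gms_hom_Q_map[OF A B f] fst_in \<xi>])
  moreover have "gms_lim (Q_obj B) (\<lambda>n. Q_unit B (R_map (Z n))) (Q_unit B b)"
    by (rule gms_lim_hom[OF isometry_hom[OF isometry_Q_unit[OF B]] R_map_in[OF Z_in] b])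
  \<comment> \<open>Each \<open>Z n\<close> satisfies the pullback equation, so the two sequences
    above coincide.\<close>
  moreover have "Q_unit B (R_map (Z n)) = Q_map B f (fst (Z n))" for n
    using K_obj_iff_unit[OF A B f, of "(Z n)"] Z_in[of n] by (simp add: R_map_def)
  ultimately have "Q_map B f \<xi> = Q_unit B b"
    using gms_lim_unique[OF QB gms_hom_in[OF gms_hom_Q_map[OF A B f] fst_in]] by simp
  then have in_K: "(\<xi>, b) \<in> pts (K_obj A B f)"
    using \<xi> b by (simp add: K_obj_iff_unit[OF A B f] gms_lim_in)
  then have "gms_lim (K_obj A B f) Z (\<xi>, b)"
    using gms_lim_isometry_iff[OF iso Z_in in_K] \<xi> by simp
  then show "\<exists>z. gms_lim (K_obj A B f) Z z \<and> R_map z = b"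
    by (auto simp: R_map_def)
qed

text \<open>The lifting property makes \<open>L_map A f\<close> a bijection onto \<open>K_obj A B f\<close>, and its inverse is
  the algebra structure. Applied to \<open>R_map\<close> itself, this reduces associativity to points in the
  image of the unit.\<close>

lemma Cauchy_lifting_imp_R_algebra:
  assumes A: "metric_sp A" and B: "metric_sp B" and f: "gms_hom A B f"
    and lift: "Cauchy_lifting A B f"
  shows "\<exists>p. R_algebra A B f p"
proof -
  let ?K = "K_obj A B f"
  note L = isometry_L_map[OF A B f] and K = metric_sp_K_obj[OF A B f]
  define p where "p = inv_into (pts A) (L_map A f)"
  have p_in: "p z \<in> pts A" and Lp: "L_map A f (p z) = z" if "z \<in> pts ?K" for z
    using Cauchy_lifting_surj_L_map[OF A B f lift that] unfolding p_def
    by (simp_all add: inv_into_into f_inv_into_f)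
  have fp: "f (p z) = R_map z" if "z \<in> pts ?K" for z
    using arg_cong[OF Lp[OF that], of snd] by (simp add: L_map_def R_map_def)
  have p_hom: "gms_hom ?K A p"
    unfolding gms_hom_def using isometry_eq[OF L p_in p_in] by (simp add: p_in Lp)
  have pL: "p (L_map A f a) = a" if a: "a \<in> pts A" for a
  proof -
    note La = isometry_in[OF L a]
    \<comment> \<open>The isometry \<open>L_map A f\<close> sends both points to the same image, so
      their distance is zero.\<close>
    have "gd A (p (L_map A f a)) a = gd ?K (L_map A f a) (L_map A f a)"
      using isometry_eq[OF L p_in[OF La] a] by (simp add: Lp[OF La])
    then show ?thesis
      by (intro metric_sp_eqI[OF A p_in[OF La] a]) (simp add: metric_sp_self[OF K La])
  qed
  have "p (R_mult A w) = p (K_map A p id w)" if w: "w \<in> pts (K_obj ?K B R_map)" for w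
  proof -
    obtain z where z: "z \<in> pts ?K" "w = L_map ?K R_map z"
      using Cauchy_lifting_surj_L_map[OF K B gms_hom_R_map Cauchy_lifting_R_map[OF A B f] w] by blast
    note iso = isometry_K_obj_fst[OF A B f]
    \<comment> \<open>At a unit point, the unit law of the monad and naturality of the unit evaluate
      both sides to \<open>p z\<close>.\<close>
    have "R_mult A w = z"
      using Q_map_unit[OF K metric_sp_Q_obj[OF A] isometry_hom[OF iso] z(1)]
      by (simp add: z(2) L_map_def R_mult_def R_map_def Q_mult_unit[OF A isometry_in[OF iso z(1)]])
    moreover have "K_map A p id w = L_map A f (p z)"
      using Q_map_unit[OF K A p_hom z(1)] fp[OF z(1)] by (simp add: z(2) L_map_def K_map_def)
    ultimately show ?thesis
      by (simp add: Lp z(1))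
  qed
  with p_hom fp pL have "R_algebra A B f p"
    by (simp add: R_algebra_def)
  then show ?thesis by blast
qed

lemma met_right_iff:
  "met_right A B f \<longleftrightarrow> metric_sp A \<and> metric_sp B \<and> gms_hom A B f \<and> Cauchy_lifting A B f"
proof
  assume "met_right A B f"
  then show "metric_sp A \<and> metric_sp B \<and> gms_hom A B f \<and> Cauchy_lifting A B f"
    using R_algebra_imp_Cauchy_lifting by (auto simp: met_right_def right_map_def)
next
  assume "metric_sp A \<and> metric_sp B \<and> gms_hom A B f \<and> Cauchy_lifting A B f"
  then show "met_right A B f"
    using Cauchy_lifting_imp_R_algebra by (auto simp: met_right_def right_map_def metric_sp_skeletal)
qed

lemma met_right_comp:
  assumes f: "met_right A B f" and g: "met_right B C g"
  shows "met_right A C (g \<circ> f)"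
proof -
  from f g have A: "metric_sp A" and C: "metric_sp C"
    and fh: "gms_hom A B f" and fl: "Cauchy_lifting A B f"
    and gh: "gms_hom B C g" and gl: "Cauchy_lifting B C g"
    by (auto simp: met_right_iff)
  have "Cauchy_lifting A C (g \<circ> f)"
    unfolding Cauchy_lifting_def
  proof (intro allI impI, elim conjE)
    fix x c assume x: "gms_Cauchy A x" and c: "gms_lim C (\<lambda>n. (g \<circ> f) (x n)) c"
    obtain b where b: "gms_lim B (\<lambda>n. f (x n)) b" "g b = c"
      using Cauchy_liftingE[OF gl gms_Cauchy_hom[OF fh x]] c by auto
    obtain a where "gms_lim A x a" "f a = b"
      by (rule Cauchy_liftingE[OF fl x b(1)])
    with b show "\<exists>a. gms_lim A x a \<and> (g \<circ> f) a = c"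
      by auto
  qed
  with A C gms_hom_comp[OF fh gh] show ?thesis
    by (simp add: met_right_iff)
qed

section \<open>The orthogonal factorisation system\<close>

lemma gms_iso_met_left_right:
  assumes A: "metric_sp A" and B: "metric_sp B" and iso: "gms_iso A B f"
  shows "met_left A B f" "met_right A B f"
proof -
  obtain g where f: "gms_hom A B f" and g: "gms_hom B A g"
    and gf: "\<And>a. a \<in> pts A \<Longrightarrow> g (f a) = a" and fg: "\<And>b. b \<in> pts B \<Longrightarrow> f (g b) = b"
    using iso by (auto simp: gms_iso_def)
  have "gd B (f a) (f a') = gd A a a'" if "a \<in> pts A" "a' \<in> pts A" for a a'
    using that gms_hom_le[OF f, of a a'] gms_hom_le[OF g, of "f a" "f a'"] by (simp add: gf gms_hom_in[OF f])
  then have "isometry A B f"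
    using gms_hom_in[OF f] by (simp add: isometry_def)
  moreover have "dense_map A B f"
    by (subst dense_map_iff[OF B f]) (use gms_hom_in[OF g] fg metric_sp_self[OF B] in force)+
  ultimately show "met_left A B f"
    using A B by (simp add: met_left_iff)
  have "Cauchy_lifting A B f"
    unfolding Cauchy_lifting_def
  proof (intro allI impI, elim conjE)
    fix x b assume x: "gms_Cauchy A x" and b: "gms_lim B (\<lambda>n. f (x n)) b"
    \<comment> \<open>The inverse supplies the lift: it carries the limit \<open>b\<close> to
      \<open>g b\<close>.\<close>
    have "gms_lim A (\<lambda>n. g (f (x n))) (g b)"
      by (rule gms_lim_hom[OF g gms_hom_in[OF f gms_Cauchy_in[OF x]] b])
    then show "\<exists>a. gms_lim A x a \<and> f a = b"
      using fg[OF gms_lim_in[OF b]] by (auto simp: gf gms_Cauchy_in[OF x])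
  qed
  with A B f show "met_right A B f"
    by (simp add: met_right_iff)
qed

lemma met_orthogonal:
  assumes e: "met_left A B e" and m: "met_right C D m"
  shows "orthogonal_maps A B e C D m"
  unfolding orthogonal_maps_def
proof (intro allI impI, elim conjE)
  fix u v assume u: "gms_hom A C u" and v: "gms_hom B D v" and sq: "\<forall>a\<in>pts A. m (u a) = v (e a)"
  from e m have A: "metric_sp A" and B: "metric_sp B" and C: "metric_sp C"
    and ei: "isometry A B e" and ed: "dense_map A B e" and ml: "Cauchy_lifting C D m"
    by (auto simp: met_left_iff met_right_iff)
  \<comment> \<open>The value \<open>c\<close> of the filler is chosen together with a sequence that
    computes it; \<open>m\<close> lifts the limit \<open>v b\<close> of the image of
    \<open>u (x n)\<close>.\<close>
  have "\<exists>x c. gms_Cauchy A x \<and> gms_lim B (\<lambda>n. e (x n)) b \<and> gms_lim C (\<lambda>n. u (x n)) c \<and> m c = v b"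
    if b: "b \<in> pts B" for b
  proof -
    obtain x where x: "gms_Cauchy A x" "gms_lim B (\<lambda>n. e (x n)) b"
      by (rule dense_isometry_Cauchy[OF B ei ed b])
    have "gms_lim D (\<lambda>n. v (e (x n))) (v b)"
      by (rule gms_lim_hom[OF v isometry_in[OF ei gms_Cauchy_in[OF x(1)]] x(2)])
    then have "gms_lim D (\<lambda>n. m (u (x n))) (v b)"
      using sq by (simp add: gms_Cauchy_in[OF x(1)])
    then obtain c where "gms_lim C (\<lambda>n. u (x n)) c" "m c = v b"
      by (rule Cauchy_liftingE[OF ml gms_Cauchy_hom[OF u x(1)]])
    with x show ?thesis by blast
  qed
  then obtain x c where x: "\<And>b. b \<in> pts B \<Longrightarrow> gms_Cauchy A (x b)"
    and lim: "\<And>b. b \<in> pts B \<Longrightarrow> gms_lim B (\<lambda>n. e (x b n)) b"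
    and ulim: "\<And>b. b \<in> pts B \<Longrightarrow> gms_lim C (\<lambda>n. u (x b n)) (c b)"
    and mc: "\<And>b. b \<in> pts B \<Longrightarrow> m (c b) = v b"
    by metis
  have x_in: "x b n \<in> pts A" if "b \<in> pts B" for b n
    by (rule gms_Cauchy_in[OF x[OF that]])
  \<comment> \<open>A filler preserves the limit of \<open>e (x b n)\<close>, so its value at
    \<open>b\<close> is a limit of \<open>u (x b n)\<close>, as \<open>c b\<close> is.\<close>
  have filler_eq: "d b = c b"
    if d: "gms_hom B C d" "\<forall>a\<in>pts A. d (e a) = u a" and b: "b \<in> pts B" for d b
  proof (rule gms_lim_unique[OF C _ _ ulim[OF b]])
    show "u (x b n) \<in> pts C" for n
      by (rule gms_hom_in[OF u x_in[OF b]])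
    have "gms_lim C (\<lambda>n. d (e (x b n))) (d b)"
      by (rule gms_lim_hom[OF d(1) isometry_in[OF ei x_in[OF b]] lim[OF b]])
    then show "gms_lim C (\<lambda>n. u (x b n)) (d b)"
      using d(2) by (simp add: x_in[OF b])
  qed
  have c_hom: "gms_hom B C c"
    unfolding gms_hom_def
  proof (intro conjI Pi_I ballI)
    fix b b' assume b: "b \<in> pts B" "b' \<in> pts B"
    \<comment> \<open>Distances of values of \<open>c\<close> are limits of distances under
      \<open>u\<close>, which are bounded by those in \<open>A\<close>; the isometry
      \<open>e\<close> identifies the latter with distances in \<open>B\<close>.\<close>
    have "(\<lambda>n. gd C (u (x b n)) (u (x b' n))) \<longlonglongrightarrow> gd C (c b) (c b')"
      using b by (intro gd_tendsto C ulim gms_hom_in[OF u] x_in)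
    moreover have "(\<lambda>n. gd B (e (x b n)) (e (x b' n))) \<longlonglongrightarrow> gd B b b'"
      using b by (intro gd_tendsto B lim isometry_in[OF ei] x_in)
    ultimately show "gd C (c b) (c b') \<le> gd B b b'"
      by (rule LIMSEQ_le) (use b in \<open>auto simp: isometry_eq[OF ei] x_in gms_hom_le[OF u]\<close>)
  qed (rule gms_lim_in[OF ulim])
  have ce: "c (e a) = u a" if a: "a \<in> pts A" for a
  proof (rule gms_lim_unique[OF C _ ulim])
    note ea = isometry_in[OF ei a]
    show "e a \<in> pts B" by (rule ea)
    show "u (x (e a) n) \<in> pts C" for n
      by (rule gms_hom_in[OF u x_in[OF ea]])
    \<comment> \<open>Whatever sequence was chosen for \<open>e a\<close>, the isometry
      \<open>e\<close> reflects its convergence to \<open>a\<close>.\<close>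
    have "gms_lim A (x (e a)) a"
      using lim[OF ea] gms_lim_isometry_iff[OF ei x_in[OF ea] a] by simp
    then show "gms_lim C (\<lambda>n. u (x (e a) n)) (u a)"
      by (rule gms_lim_hom[OF u x_in[OF ea]])
  qed
  show "\<exists>!d. d \<in> extensional (pts B) \<and> gms_hom B C d \<and>
      (\<forall>a\<in>pts A. d (e a) = u a) \<and> (\<forall>b\<in>pts B. m (d b) = v b)"
  \<comment> \<open>Restriction fixes the values of \<open>c\<close> outside \<open>pts B\<close>,
    as uniqueness among extensional functions requires.\<close>
  proof (rule ex1I[of _ "restrict c (pts B)"])
    show "restrict c (pts B) \<in> extensional (pts B) \<and> gms_hom B C (restrict c (pts B)) \<and>
      (\<forall>a\<in>pts A. restrict c (pts B) (e a) = u a) \<and> (\<forall>b\<in>pts B. m (restrict c (pts B) b) = v b)"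
      using c_hom by (auto simp: gms_hom_def ce mc isometry_in[OF ei])
  next
    fix d assume "d \<in> extensional (pts B) \<and> gms_hom B C d \<and>
      (\<forall>a\<in>pts A. d (e a) = u a) \<and> (\<forall>b\<in>pts B. m (d b) = v b)"
    then show "d = restrict c (pts B)"
      using filler_eq by (intro extensionalityI[of _ "pts B"]) auto
  qed
qed

text \<open>Factorisations, isomorphisms in both classes, closure under composition and unique
  diagonals already make each class the orthogonal complement of the other, so together they express
  an orthogonal factorisation system.\<close>

theorem corollary14p3:
  shows
    "(\<forall>(A :: 'a gms) (B :: 'b gms) f. metric_sp A \<and> metric_sp B \<and> gms_hom A B f \<longrightarrow>
        metric_sp (K_obj A B f) \<and>
        met_left A (K_obj A B f) (L_map A f) \<and>
        met_right (K_obj A B f) B R_map \<and>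
        (\<forall>a\<in>pts A. R_map (L_map A f a) = f a)) \<and>
     (\<forall>(A :: 'a gms) (B :: 'b gms) f. metric_sp A \<and> metric_sp B \<and> gms_iso A B f \<longrightarrow>
        met_left A B f \<and> met_right A B f) \<and>
     (\<forall>(A :: 'a gms) (B :: 'b gms) (C :: 'c gms) f g.
        met_left A B f \<and> met_left B C g \<longrightarrow> met_left A C (g \<circ> f)) \<and>
     (\<forall>(A :: 'a gms) (B :: 'b gms) (C :: 'c gms) f g.
        met_right A B f \<and> met_right B C g \<longrightarrow> met_right A C (g \<circ> f)) \<and>
     (\<forall>(A :: 'a gms) (B :: 'b gms) (C :: 'c gms) (D :: 'd gms) e m.
        met_left A B e \<and> met_right C D m \<longrightarrow> orthogonal_maps A B e C D m) \<and>
     (\<forall>(A :: 'a gms) (B :: 'b gms) f. metric_sp A \<and> metric_sp B \<and> gms_hom A B f \<longrightarrow>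
        (met_left A B f \<longleftrightarrow> isometry A B f \<and> dense_map A B f))"
proof (intro conjI allI impI; (elim conjE)?)
  fix A :: "'a gms" and B :: "'b gms" and f
  assume hyps: "metric_sp A" "metric_sp B" "gms_hom A B f"
  show "metric_sp (K_obj A B f)"
    by (rule metric_sp_K_obj[OF hyps])
  show "met_left A (K_obj A B f) (L_map A f)"
    by (simp add: met_left_iff metric_sp_K_obj isometry_L_map dense_L_map hyps)
  show "met_right (K_obj A B f) B R_map"
    by (simp add: met_right_iff metric_sp_K_obj gms_hom_R_map Cauchy_lifting_R_map hyps)
  show "\<forall>a\<in>pts A. R_map (L_map A f a) = f a"
    by (simp add: R_map_def L_map_def)
  show "met_left A B f \<longleftrightarrow> isometry A B f \<and> dense_map A B f"
    using hyps by (simp add: met_left_iff)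
qed (blast intro: gms_iso_met_left_right met_left_comp met_right_comp met_orthogonal)+

end
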